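(* Let $\mathcal{A}\in\mathbb{C}^{I(N)\times I(N)}$ be an arbitrary core invertible tensor. Then $\mathcal{A}$ has one and only one core inverse.
   Context: Let $I_1,\dots,I_N$ be positive integers. $\mathbb{C}^{I(N)\times I(N)}$ denotes the set of complex tensors of order $2N$ with entries $\mathcal{A}_{i_1\dots i_N j_1\dots j_N}$, where $1\le i_k,j_k\le I_k$. The Einstein product is $(\mathcal{A}*_N\mathcal{B})_{i_1\dots i_N j_1\dots j_N}=\sum_{k_1,\dots,k_N}\mathcal{A}_{i_1\dots i_N k_1\dots k_N}\mathcal{B}_{k_1\dots k_N j_1\dots j_N}$, and powers $\mathcal{A}^p$ are taken with respect to $*_N$. The conjugate transpose $\mathcal{A}^*$ is defined by $(\mathcal{A}^* )_{j_1\dots j_N i_1\dots i_N}=\overline{\mathcal{A}_{i_1\dots i_N j_1\dots j_N}}$. A core inverse of $\mathcal{A}$ is a tensor $\mathcal{X}\in\mathbb{C}^{I(N)\times I(N)}$ satisfying $\mathcal{X}*_N\mathcal{A}^2=\mathcal{A}$, $\mathcal{A}*_N\mathcal{X}^2=\mathcal{X}$, and $(\mathcal{A}*_N\mathcal{X})^*=\mathcal{A}*_N\mathcal{X}$. The tensor $\mathcal{A}$ is called core invertible if a core inverse of $\mathcal{A}$ exists. *)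

theory Defs
  imports Complex_Main "HOL-Library.FuncSet"
begin

text \<open>
  A multi-index \<open>(i\<^sub>1, \<dots>, i\<^sub>N)\<close> with \<open>1 \<le> i\<^sub>k \<le> I\<^sub>k\<close> is a function on \<open>{1..N}\<close>, and a tensor is a
  function of a pair of multi-indices. Both are extensional (equal to \<open>undefined\<close> outside
  their domain), so that HOL equality of tensors is entrywise equality.
\<close>

definition multi_idx :: "nat \<Rightarrow> (nat \<Rightarrow> nat) \<Rightarrow> (nat \<Rightarrow> nat) set" where
  "multi_idx N I = (\<Pi>\<^sub>E k\<in>{1..N}. {1..I k})"

type_synonym tensor = "(nat \<Rightarrow> nat) \<times> (nat \<Rightarrow> nat) \<Rightarrow> complex"

definition tensors :: "nat \<Rightarrow> (nat \<Rightarrow> nat) \<Rightarrow> tensor set" where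
  "tensors N I = (multi_idx N I \<times> multi_idx N I) \<rightarrow>\<^sub>E UNIV"

definition einstein_prod :: "nat \<Rightarrow> (nat \<Rightarrow> nat) \<Rightarrow> tensor \<Rightarrow> tensor \<Rightarrow> tensor" where
  "einstein_prod N I A B =
     (\<lambda>(i, j)\<in>multi_idx N I \<times> multi_idx N I. \<Sum>k\<in>multi_idx N I. A (i, k) * B (k, j))"

definition conj_transpose :: "nat \<Rightarrow> (nat \<Rightarrow> nat) \<Rightarrow> tensor \<Rightarrow> tensor" where
  "conj_transpose N I A = (\<lambda>(j, i)\<in>multi_idx N I \<times> multi_idx N I. cnj (A (i, j)))"

definition is_core_inverse :: "nat \<Rightarrow> (nat \<Rightarrow> nat) \<Rightarrow> tensor \<Rightarrow> tensor \<Rightarrow> bool" where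
  "is_core_inverse N I A X \<longleftrightarrow>
     X \<in> tensors N I \<and>
     einstein_prod N I X (einstein_prod N I A A) = A \<and>
     einstein_prod N I A (einstein_prod N I X X) = X \<and>
     conj_transpose N I (einstein_prod N I A X) = einstein_prod N I A X"

definition core_invertible :: "nat \<Rightarrow> (nat \<Rightarrow> nat) \<Rightarrow> tensor \<Rightarrow> bool" where
  "core_invertible N I A \<longleftrightarrow> (\<exists>X. is_core_inverse N I A X)"

end

theory Submission imports Defs begin

text \<open>
  Write \<open>P = A X\<close> and \<open>Q = A Y\<close> for two core inverses \<open>X\<close>, \<open>Y\<close>. From \<open>A X A = A\<close> and
  \<open>A Y A = A\<close> follow \<open>P Q = Q\<close> and \<open>Q P = P\<close>, and taking adjoints shows that the Hermitian
  \<open>P\<close> and \<open>Q\<close> coincide. Then \<open>X = X A X = X A Y = X A\<^sup>2 Y\<^sup>2 = A Y\<^sup>2 = Y\<close>.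
\<close>

lemma einstein_prod_apply:
  "i \<in> multi_idx N I \<Longrightarrow> j \<in> multi_idx N I \<Longrightarrow>
    einstein_prod N I A B (i, j) = (\<Sum>k\<in>multi_idx N I. A (i, k) * B (k, j))"
  by (simp add: einstein_prod_def)

text \<open>Both sides are \<open>undefined\<close> off the index square; on it the claim is an
  exchange of two sums.\<close>

lemma einstein_prod_assoc:
  "einstein_prod N I (einstein_prod N I A B) C = einstein_prod N I A (einstein_prod N I B C)"
proof -
  have "(\<Sum>k\<in>M. (\<Sum>l\<in>M. A (i, l) * B (l, k)) * C (k, j)) =
        (\<Sum>k\<in>M. A (i, k) * (\<Sum>l\<in>M. B (k, l) * C (l, j)))" for M i j
    unfolding sum_distrib_left sum_distrib_right
    by (subst sum.swap) (simp add: mult.assoc)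
  then show ?thesis
    \<comment> \<open>Only the two outer products are unfolded; the inner ones are evaluated
      entrywise.\<close>
    by (subst (1 3) einstein_prod_def)
      (auto simp: restrict_def fun_eq_iff einstein_prod_apply)
qed

lemma conj_transpose_einstein_prod:
  "conj_transpose N I (einstein_prod N I A B) =
    einstein_prod N I (conj_transpose N I B) (conj_transpose N I A)"
  by (auto simp: conj_transpose_def einstein_prod_def restrict_def fun_eq_iff mult.commute
      intro!: sum.cong)

text \<open>\<open>A X A = A X (X A A) = (A X X) A A = X A A = A\<close>.\<close>

lemma core_inverse_inner:
  assumes "is_core_inverse N I A X"
  shows "einstein_prod N I A (einstein_prod N I X A) = A"
  using assms unfolding is_core_inverse_def by (metis einstein_prod_assoc)

text \<open>\<open>X A X = X A (A X X) = (X A A) X X = A X X = X\<close>.\<close>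

lemma core_inverse_outer:
  assumes "is_core_inverse N I A X"
  shows "einstein_prod N I X (einstein_prod N I A X) = X"
  using assms unfolding is_core_inverse_def by (metis einstein_prod_assoc)

text \<open>Both products are the orthogonal projection onto the range of \<open>A\<close>.\<close>

lemma core_inverse_range_projection_eq:
  assumes X: "is_core_inverse N I A X" and Y: "is_core_inverse N I A Y"
  shows "einstein_prod N I A X = einstein_prod N I A Y"
proof -
  let ?P = "einstein_prod N I A X" and ?Q = "einstein_prod N I A Y"
  have PQ: "einstein_prod N I ?P ?Q = ?Q"
    using core_inverse_inner[OF X] by (metis einstein_prod_assoc)
  have QP: "einstein_prod N I ?Q ?P = ?P"
    using core_inverse_inner[OF Y] by (metis einstein_prod_assoc)
  have herm: "conj_transpose N I ?P = ?P" "conj_transpose N I ?Q = ?Q"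
    using X Y by (simp_all add: is_core_inverse_def)
  have "?Q = conj_transpose N I (einstein_prod N I ?P ?Q)"
    by (simp add: PQ herm)
  \<comment> \<open>The adjoint reverses the product, turning \<open>P Q\<close> into
    \<open>Q P\<close>.\<close>
  also have "\<dots> = ?P"
    by (simp only: conj_transpose_einstein_prod[of N I ?P ?Q] herm QP)
  finally show ?thesis ..
qed

lemma core_inverse_unique:
  assumes X: "is_core_inverse N I A X" and Y: "is_core_inverse N I A Y"
  shows "X = Y"
proof -
  have XA2: "einstein_prod N I X (einstein_prod N I A A) = A"
    and AY2: "einstein_prod N I A (einstein_prod N I Y Y) = Y"
    using X Y by (simp_all add: is_core_inverse_def)
  have "X = einstein_prod N I X (einstein_prod N I A Y)"
    using core_inverse_outer[OF X] core_inverse_range_projection_eq[OF X Y] by simp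
  also have "\<dots> = Y"
    using XA2 AY2 by (metis einstein_prod_assoc)
  finally show ?thesis .
qed

theorem theorem3p1:
  fixes N :: nat and I :: "nat \<Rightarrow> nat" and A :: tensor
  assumes "N \<ge> 1"
    and "\<And>k. k \<in> {1..N} \<Longrightarrow> I k \<ge> 1"
    and "A \<in> tensors N I"
    and "core_invertible N I A"
  shows "\<exists>!X. is_core_inverse N I A X"
  using assms(4) core_inverse_unique unfolding core_invertible_def by blast

end
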